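(* Suppose $m\equiv 5\pmod{20}$ is a positive integer and there exists a resolvable $(m,5,1)$-BIBD. Let $Q$ be a prime power such that $Q\ge m+1$, and let $n$ be an integer with $2m/5\le n\le m(m-1)/20$. Then the following RTS exist: (1) a $(2,n,5)$-RTS with restricted repairability, with shares from $(\mathbb{F}_Q)^5$, having information rate $4/5$ and communication complexity $5/4$; (2) a $(3,n,5)$-RTS with restricted repairability, with shares from $(\mathbb{F}_Q)^5$, having information rate $2/5$ and communication complexity $5/2$.
   Context: Designs. An $(m,d,1)$-BIBD is a set of $m$ points together with a collection of blocks, each a $d$-subset of the points, such that every pair of distinct points occurs in exactly one block. It is resolvable if its blocks can be partitioned into parallel classes, where each parallel class consists of $m/d$ pairwise disjoint blocks. Threshold schemes. For $2\le k\le n$, a $(k,n)$-threshold scheme is a (randomized) method by which a dealer chooses a secret from a finite set $\mathcal{K}$ and gives a share, from a finite set $\mathcal{S}$ of possible shares, to each of $n$ players $P_1,\dots,P_n$, such that any $k$ players can compute the secret from their shares, and no $k-1$ players obtain any information about the secret (unconditionally: the distribution of their shares does not depend on the secret). Its information rate is $\log_2|\mathcal{K}|/\log_2|\mathcal{S}|$. Repairing. A repairing protocol lets a player $P_\ell$ who lost their share recover exactly that share, without the dealer, with help from a set of $d$ other players (not all of whom need actually send anything; $d$ is the repairing degree), over secure pairwise channels. It has two phases. In the message exchange phase (possibly empty) each of the $d$ players, using their own share and private randomness, simultaneously sends at most one message to each other member of the set. In the repairing phase the $d$ players each send a message to $P_\ell$ (depending on their share, randomness and the messages received), from which $P_\ell$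 computes the lost share. Security: all players follow the protocol honestly, and for every coalition of $k-1$ players (which may or may not include $P_\ell$), the shares of the coalition together with all messages its members sent or received in the execution of the protocol give no information about the secret. A $(k,n)$-threshold scheme with such a secure protocol with repairing degree $d$ is a $(k,n,d)$-RTS (repairable threshold scheme). It has restricted repairability if for every player there exists a set of $d$ other players who can repair that player's share. The communication complexity of a repairing protocol is the sum of the bit-lengths of all messages transmitted divided by the bit-length of the secret (an element of a set of size $N$ has bit-length $\log_2 N$). *)

theory Defs
  imports
    "HOL-Analysis.Finite_Cartesian_Product"
    "HOL-Library.Disjoint_Sets"
    "HOL-Library.FuncSet"
    "HOL-Library.Numeral_Type"
    "HOL-Number_Theory.Cong"
    "HOL-Number_Theory.Prime_Powers"
    "HOL-Probability.Product_PMF"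
begin

section \<open>Resolvable designs\<close>

text \<open>
  The blocks form a set rather than a multiset: for \<open>d \<ge> 2\<close> a repeated block would put some
  pair of points in two blocks.
\<close>

definition bibd :: "nat \<Rightarrow> nat \<Rightarrow> 'p set \<Rightarrow> 'p set set \<Rightarrow> bool" where
  "bibd m d X \<B> \<longleftrightarrow>
     finite X \<and> card X = m \<and> (\<forall>B\<in>\<B>. B \<subseteq> X \<and> card B = d) \<and>
     (\<forall>x\<in>X. \<forall>y\<in>X. x \<noteq> y \<longrightarrow> (\<exists>!B. B \<in> \<B> \<and> x \<in> B \<and> y \<in> B))"

definition parallel_class :: "nat \<Rightarrow> nat \<Rightarrow> 'p set set \<Rightarrow> bool" where
  "parallel_class m d P \<longleftrightarrow> finite P \<and> disjoint P \<and> real (card P) = real m / real d"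

definition resolvable_bibd :: "nat \<Rightarrow> nat \<Rightarrow> 'p set \<Rightarrow> 'p set set \<Rightarrow> bool" where
  "resolvable_bibd m d X \<B> \<longleftrightarrow>
     bibd m d X \<B> \<and> (\<exists>\<C>. partition_on \<B> \<C> \<and> (\<forall>P\<in>\<C>. parallel_class m d P))"

section \<open>Threshold schemes\<close>

text \<open>
  The players are \<open>1, \<dots>, n\<close>, and \<open>deal D s\<close> is the joint distribution of the shares when the
  secret is \<open>s\<close>. No distribution on the secrets is assumed: that a quantity gives no information
  about the secret means that its distribution is the same for every secret.
\<close>

record ('k, 's) sharing_scheme =
  secrets :: "'k set"
  shares :: "'s set"
  deal :: "'k \<Rightarrow> (nat \<Rightarrow> 's) pmf"

definition threshold_scheme :: "nat \<Rightarrow> nat \<Rightarrow> ('k, 's) sharing_scheme \<Rightarrow> bool" where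
  "threshold_scheme k n D \<longleftrightarrow>
     2 \<le> k \<and> k \<le> n \<and>
     finite (secrets D) \<and> secrets D \<noteq> {} \<and> finite (shares D) \<and>
     (\<forall>s\<in>secrets D. set_pmf (deal D s) \<subseteq> {1..n} \<rightarrow>\<^sub>E shares D) \<and>
     (\<forall>A\<subseteq>{1..n}. card A = k \<longrightarrow>
        (\<exists>g. \<forall>s\<in>secrets D. \<forall>\<sigma>\<in>set_pmf (deal D s). g (restrict \<sigma> A) = s)) \<and>
     (\<forall>A\<subseteq>{1..n}. card A = k - 1 \<longrightarrow>
        (\<forall>s\<in>secrets D. \<forall>s'\<in>secrets D.
           map_pmf (\<lambda>\<sigma>. restrict \<sigma> A) (deal D s) = map_pmf (\<lambda>\<sigma>. restrict \<sigma> A) (deal D s')))"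

definition bit_length :: "'a set \<Rightarrow> real" where
  "bit_length A = log 2 (real (card A))"

definition information_rate :: "('k, 's) sharing_scheme \<Rightarrow> real" where
  "information_rate D = bit_length (secrets D) / bit_length (shares D)"

section \<open>Repairing protocols\<close>

text \<open>
  A protocol for repairing the share of one fixed player \<open>l\<close>. A pair \<open>(i, j)\<close> in
  \<open>exch_links\<close> says that helper \<open>i\<close> sends one message to helper \<open>j\<close> in the message
  exchange phase; \<open>rep_senders\<close> are the helpers who send a message to \<open>l\<close> in the repairing phase.
  The arguments of \<open>exch_msg\<close> are the link, the sender's share and the sender's randomness.
  The arguments of \<open>rep_msg\<close> are the sender, the sender's share and randomness, and the messages
  the sender received in the exchange phase, indexed by their senders.
\<close>

record ('s, 'r, 'x) repair_protocol =
  helpers :: "nat set"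
  randomness :: "nat \<Rightarrow> 'r pmf"
  exch_links :: "(nat \<times> nat) set"
  exch_msg :: "nat \<times> nat \<Rightarrow> 's \<Rightarrow> 'r \<Rightarrow> 'x"
  rep_senders :: "nat set"
  rep_msg :: "nat \<Rightarrow> 's \<Rightarrow> 'r \<Rightarrow> (nat \<Rightarrow> 'x) \<Rightarrow> 'x"
  rebuild :: "(nat \<Rightarrow> 'x) \<Rightarrow> 's"

definition exch_transcript ::
  "('s, 'r, 'x) repair_protocol \<Rightarrow> (nat \<Rightarrow> 's) \<times> (nat \<Rightarrow> 'r) \<Rightarrow> nat \<times> nat \<Rightarrow> 'x" where
  "exch_transcript P = (\<lambda>(\<sigma>, r).
     (\<lambda>e\<in>exch_links P. exch_msg P e (\<sigma> (fst e)) (r (fst e))))"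

definition rep_transcript ::
  "('s, 'r, 'x) repair_protocol \<Rightarrow> (nat \<Rightarrow> 's) \<times> (nat \<Rightarrow> 'r) \<Rightarrow> nat \<Rightarrow> 'x" where
  "rep_transcript P = (\<lambda>(\<sigma>, r).
     (\<lambda>i\<in>rep_senders P. rep_msg P i (\<sigma> i) (r i)
        (\<lambda>j\<in>{j. (j, i) \<in> exch_links P}. exch_transcript P (\<sigma>, r) (j, i))))"

text \<open>
  An execution is determined by the dealt shares and the helpers' private random values, which are
  independent of one another and of the shares.
\<close>

definition execution ::
  "('k, 's) sharing_scheme \<Rightarrow> ('s, 'r, 'x) repair_protocol \<Rightarrow> 'k \<Rightarrow>
     ((nat \<Rightarrow> 's) \<times> (nat \<Rightarrow> 'r)) pmf" where
  "execution D P s = pair_pmf (deal D s) (Pi_pmf (helpers P) undefined (randomness P))"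

definition executions ::
  "('k, 's) sharing_scheme \<Rightarrow> ('s, 'r, 'x) repair_protocol \<Rightarrow>
     ((nat \<Rightarrow> 's) \<times> (nat \<Rightarrow> 'r)) set" where
  "executions D P = (\<Union>s\<in>secrets D. set_pmf (execution D P s))"

text \<open>The sets of messages that can occur on an exchange link, respectively from a helper to \<open>l\<close>.\<close>

definition exch_space ::
  "('k, 's) sharing_scheme \<Rightarrow> ('s, 'r, 'x) repair_protocol \<Rightarrow> nat \<times> nat \<Rightarrow> 'x set" where
  "exch_space D P e = (\<lambda>w. exch_transcript P w e) ` executions D P"

definition rep_space ::
  "('k, 's) sharing_scheme \<Rightarrow> ('s, 'r, 'x) repair_protocol \<Rightarrow> nat \<Rightarrow> 'x set" where
  "rep_space D P i = (\<lambda>w. rep_transcript P w i) ` executions D P"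

text \<open>
  The message sets are required to be finite because \<open>card\<close>, and hence \<open>bit_length\<close>, is \<open>0\<close> on
  infinite sets.
\<close>

definition repairs ::
  "nat \<Rightarrow> nat \<Rightarrow> ('k, 's) sharing_scheme \<Rightarrow> nat \<Rightarrow> ('s, 'r, 'x) repair_protocol \<Rightarrow> bool" where
  "repairs n d D l P \<longleftrightarrow>
     helpers P \<subseteq> {1..n} - {l} \<and> card (helpers P) = d \<and>
     exch_links P \<subseteq> {(i, j). i \<in> helpers P \<and> j \<in> helpers P \<and> i \<noteq> j} \<and>
     rep_senders P \<subseteq> helpers P \<and>
     (\<forall>e\<in>exch_links P. finite (exch_space D P e)) \<and>
     (\<forall>i\<in>rep_senders P. finite (rep_space D P i)) \<and>
     (\<forall>(\<sigma>, r)\<in>executions D P. rebuild P (rep_transcript P (\<sigma>, r)) = \<sigma> l)"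

text \<open>The shares of a coalition \<open>C\<close> and all messages that its members sent or received.\<close>

definition view ::
  "nat \<Rightarrow> ('s, 'r, 'x) repair_protocol \<Rightarrow> nat set \<Rightarrow> (nat \<Rightarrow> 's) \<times> (nat \<Rightarrow> 'r) \<Rightarrow>
     (nat \<Rightarrow> 's) \<times> (nat \<times> nat \<Rightarrow> 'x) \<times> (nat \<Rightarrow> 'x)" where
  "view l P C = (\<lambda>(\<sigma>, r).
     (restrict \<sigma> C,
      restrict (exch_transcript P (\<sigma>, r)) {(i, j) \<in> exch_links P. i \<in> C \<or> j \<in> C},
      restrict (rep_transcript P (\<sigma>, r)) {i \<in> rep_senders P. i \<in> C \<or> l \<in> C}))"

definition secure_repair ::
  "nat \<Rightarrow> nat \<Rightarrow> ('k, 's) sharing_scheme \<Rightarrow> nat \<Rightarrow> ('s, 'r, 'x) repair_protocol \<Rightarrow> bool" where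
  "secure_repair k n D l P \<longleftrightarrow>
     (\<forall>C\<subseteq>{1..n}. card C = k - 1 \<longrightarrow>
        (\<forall>s\<in>secrets D. \<forall>s'\<in>secrets D.
           map_pmf (view l P C) (execution D P s) = map_pmf (view l P C) (execution D P s')))"

definition communication_complexity ::
  "('k, 's) sharing_scheme \<Rightarrow> ('s, 'r, 'x) repair_protocol \<Rightarrow> real" where
  "communication_complexity D P =
     ((\<Sum>e\<in>exch_links P. bit_length (exch_space D P e)) +
      (\<Sum>i\<in>rep_senders P. bit_length (rep_space D P i))) / bit_length (secrets D)"

text \<open>
  A \<open>(k, n, d)\<close>-RTS with restricted repairability. \<open>R l\<close> is the protocol that repairs the share of
  player \<open>l\<close>; it includes the set of helpers for \<open>l\<close>.
\<close>

definition restricted_rts ::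
  "nat \<Rightarrow> nat \<Rightarrow> nat \<Rightarrow> ('k, 's) sharing_scheme \<Rightarrow> (nat \<Rightarrow> ('s, 'r, 'x) repair_protocol) \<Rightarrow> bool" where
  "restricted_rts k n d D R \<longleftrightarrow>
     threshold_scheme k n D \<and> (\<forall>l\<in>{1..n}. repairs n d D l (R l) \<and> secure_repair k n D l (R l))"

end

theory Submission
  imports Defs "HOL-Computational_Algebra.Polynomial"
begin

text \<open>
  Identify the points of the design with elements of the field and let every player hold the values
  of a random polynomial at the points of a block. One block has \<open>5\<close> points and two blocks have at
  least \<open>9\<close>; two blocks have at most \<open>10\<close> points and three blocks at least \<open>12\<close>. Hence the top \<open>4\<close>
  coefficients of a polynomial with \<open>9\<close> coefficients, respectively the top \<open>2\<close> of \<open>12\<close>, can serve as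
  the secret. If the chosen blocks include two parallel classes, each point of a block lies in another
  chosen block, and these blocks differ for different points; so a lost share is recovered from one
  field element sent by each of five helpers. Such messages reveal nothing beyond the shares of the
  players who see them.
\<close>

section \<open>Polynomials given by coefficient lists\<close>

text \<open>\<open>Poly\<close> strips trailing zeros, so a polynomial determines its coefficient
  list only once the length is fixed.\<close>

lemma Poly_eq_iff_same_length:
  assumes "length u = length v" "Poly u = Poly v"
  shows "u = v"
proof (rule nth_equalityI)
  fix i assume "i < length u"
  then show "u ! i = v ! i"
    using assms by (metis coeff_Poly_eq nth_default_nth)
qed (use assms in simp)

text \<open>The difference has degree below the common length but vanishes on all of
  \<open>T\<close>, so it has too many roots to be nonzero.\<close>

lemma coeff_lists_eq_if_agree:
  fixes u v :: "'f::field list"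
  assumes len: "length u = length v" and fin: "finite T" and card: "length u \<le> card T"
    and agree: "\<And>x. x \<in> T \<Longrightarrow> poly (Poly u) x = poly (Poly v) x"
  shows "u = v"
proof (cases "u = []")
  case True
  then show ?thesis using len by simp
next
  case False
  let ?p = "Poly u - Poly v"
  have "?p = 0"
  proof (rule ccontr)
    assume nz: "?p \<noteq> 0"
    have "coeff ?p i = 0" if "i \<ge> length u" for i
      using that len by (simp add: coeff_Poly_eq nth_default_beyond)
    then have deg: "degree ?p < length u"
      using nz leading_coeff_0_iff[of ?p] by (meson not_le)
    have "card T \<le> card {x. poly ?p x = 0}"
      using agree by (intro card_mono poly_roots_finite nz) auto
    also have "\<dots> \<le> degree ?p" by (rule card_poly_roots_bound[OF nz])
    finally show False using deg card by linarith
  qed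
  then show ?thesis using len by (intro Poly_eq_iff_same_length) auto
qed

lemma poly_Poly_append:
  fixes u s :: "'f::comm_semiring_1 list"
  shows "poly (Poly (u @ s)) x = poly (Poly u) x + x ^ length u * poly (Poly s) x"
  by (induction u) (auto simp: algebra_simps)

text \<open>The fixed top part \<open>s\<close> adds the same known term at each point to the values
  for every \<open>u\<close>, so injectivity reduces to uniqueness of interpolation at
  \<open>t\<close> points. Equal cardinalities then give surjectivity. Hence a uniform
  \<open>u\<close> yields uniform values on \<open>T\<close>, whatever \<open>s\<close> is.\<close>

lemma evaluation_bij_betw:
  fixes s :: "'f::{field,finite} list" and T :: "'f set"
  assumes "card T = t"
  shows "bij_betw (\<lambda>u. \<lambda>x\<in>T. poly (Poly (u @ s)) x) {u. length u = t} (T \<rightarrow>\<^sub>E UNIV)"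
proof -
  let ?E = "\<lambda>u. \<lambda>x\<in>T. poly (Poly (u @ s)) x" and ?U = "{u::'f list. length u = t}"
  have inj: "inj_on ?E ?U"
  proof (rule inj_onI)
    fix u v assume uv: "u \<in> ?U" "v \<in> ?U" and eq: "?E u = ?E v"
    show "u = v"
    proof (rule coeff_lists_eq_if_agree[of _ _ T])
      fix x assume "x \<in> T"
      then show "poly (Poly u) x = poly (Poly v) x"
        using fun_cong[OF eq, of x] uv by (simp add: poly_Poly_append)
    qed (use uv assms in simp_all)
  qed
  have "card ?U = card (T \<rightarrow>\<^sub>E (UNIV::'f set))"
    using card_lists_length_eq[of "UNIV::'f set" t] assms by (simp add: card_PiE)
  then have "?E ` ?U = T \<rightarrow>\<^sub>E UNIV"
    using inj by (intro card_subset_eq) (auto simp: card_image finite_PiE)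
  with inj show ?thesis by (simp add: bij_betw_def)
qed

section \<open>Shares composed of evaluations\<close>

lemma log_card_nonzero: "log 2 (real CARD('f::{zero_neq_one,finite})) \<noteq> 0"
proof -
  have "CARD('f) \<ge> 2" using card_mono[of UNIV "{0, 1::'f}"] by simp
  then have "log 2 (real CARD('f)) \<ge> 1" by simp
  then show ?thesis by linarith
qed

text \<open>Here \<open>t\<close> counts the random coefficients and \<open>w\<close> those forming
  the secret. The bound \<open>few\<close> gives privacy and \<open>many\<close> gives
  reconstruction, while \<open>covered\<close> and \<open>meet\<close> supply distinct helpers for
  the coordinates of a lost share.\<close>

locale evaluation_rts =
  fixes pts :: "nat \<Rightarrow> 'd::finite \<Rightarrow> 'f::{field,finite}" and n k t w :: nat
  assumes k_ge: "2 \<le> k" and k_le: "k \<le> n" and t_pos: "0 < t"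
    and t_le: "t \<le> CARD('f)"
    and inj_pts: "i \<in> {1..n} \<Longrightarrow> inj (pts i)"
    and meet: "i \<in> {1..n} \<Longrightarrow> i' \<in> {1..n} \<Longrightarrow> i \<noteq> i' \<Longrightarrow>
      x \<in> range (pts i) \<inter> range (pts i') \<Longrightarrow> y \<in> range (pts i) \<inter> range (pts i') \<Longrightarrow> x = y"
    and covered: "i \<in> {1..n} \<Longrightarrow> \<exists>i'\<in>{1..n} - {i}. pts i j \<in> range (pts i')"
    and few: "A \<subseteq> {1..n} \<Longrightarrow> card A = k - 1 \<Longrightarrow> card (\<Union>i\<in>A. range (pts i)) \<le> t"
    and many: "A \<subseteq> {1..n} \<Longrightarrow> card A = k \<Longrightarrow> t + w \<le> card (\<Union>i\<in>A. range (pts i))"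
begin

section \<open>The evaluation scheme, its privacy and its reconstruction\<close>

definition coeffs :: "'f list set" where
  "coeffs = {u. length u = t}"

definition share_of :: "'f list \<Rightarrow> nat \<Rightarrow> 'f ^ 'd" where
  "share_of c = (\<lambda>i\<in>{1..n}. \<chi> j. poly (Poly c) (pts i j))"

text \<open>The random coefficients come first and the secret occupies the top ones. In the opposite
  order, a player holding the value at the point 0 would read off a coefficient of the
  secret.\<close>

definition scheme :: "('f list, 'f ^ 'd) sharing_scheme" where
  "scheme = \<lparr>secrets = {s. length s = w}, shares = UNIV,
     deal = \<lambda>s. map_pmf (\<lambda>u. share_of (u @ s)) (pmf_of_set coeffs)\<rparr>"

lemma coeffs_finite: "finite coeffs" and coeffs_nonempty: "coeffs \<noteq> {}"
  using finite_lists_length_eq[of "UNIV::'f set" t] length_replicate[of t "0::'f"]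
  by (auto simp: coeffs_def simp del: length_replicate)

lemma scheme_simps [simp]:
  "secrets scheme = {s. length s = w}" "shares scheme = UNIV"
  by (simp_all add: scheme_def)

lemma deal_scheme: "deal scheme s = map_pmf (\<lambda>u. share_of (u @ s)) (pmf_of_set coeffs)"
  by (simp add: scheme_def)

lemma set_deal: "set_pmf (deal scheme s) = (\<lambda>u. share_of (u @ s)) ` coeffs"
  by (simp add: deal_scheme coeffs_finite coeffs_nonempty)

lemma card_secrets: "card (secrets scheme) = CARD('f) ^ w"
  using card_lists_length_eq[of "UNIV::'f set" w] by simp

lemma bit_length_secrets: "bit_length (secrets scheme) = real w * log 2 (real CARD('f))"
  unfolding bit_length_def card_secrets by (simp add: log_nat_power)

lemma finite_secrets: "finite (secrets scheme)"
  using finite_lists_length_eq[of "UNIV::'f set" w] by simp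

lemma share_of_nth: "i \<in> {1..n} \<Longrightarrow> share_of c i $ j = poly (Poly c) (pts i j)"
  by (simp add: share_of_def)

lemma secrecy:
  assumes A: "A \<subseteq> {1..n}" "card A = k - 1"
  shows "map_pmf (\<lambda>\<sigma>. restrict \<sigma> A) (deal scheme s) = map_pmf (\<lambda>\<sigma>. restrict \<sigma> A) (deal scheme s')"
proof -
  let ?T = "\<Union>i\<in>A. range (pts i)"
  \<comment> \<open>The coalition may see fewer than \<open>t\<close> points. Adding further points
    makes \<open>evaluation_bij_betw\<close> applicable; \<open>G\<close> then reads the shares off
    the table of values on \<open>T\<close>.\<close>
  obtain T where T: "?T \<subseteq> T" "card T = t"
    using exists_subset_between[OF few[OF A] t_le subset_UNIV finite] by auto
  define G where "G e = (\<lambda>i\<in>A. \<chi> j. e (pts i j))" for e :: "'f \<Rightarrow> 'f"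
  have "map_pmf (\<lambda>\<sigma>. restrict \<sigma> A) (deal scheme s) = map_pmf G (pmf_of_set (T \<rightarrow>\<^sub>E UNIV))" for s
  proof -
    have "map_pmf (\<lambda>\<sigma>. restrict \<sigma> A) (deal scheme s) =
        map_pmf (\<lambda>u. G (\<lambda>x\<in>T. poly (Poly (u @ s)) x)) (pmf_of_set coeffs)"
      unfolding deal_scheme map_pmf_comp
    proof (rule map_pmf_cong[OF refl])
      fix u
      show "restrict (share_of (u @ s)) A = G (\<lambda>x\<in>T. poly (Poly (u @ s)) x)"
      proof
        fix i
        have "pts i j \<in> T" if "i \<in> A" for j using T(1) that by auto
        then show "restrict (share_of (u @ s)) A i = G (\<lambda>x\<in>T. poly (Poly (u @ s)) x) i"
          using A(1) by (cases "i \<in> A") (simp_all add: G_def share_of_def vec_eq_iff subset_iff)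
      qed
    qed
    also have "\<dots> = map_pmf G (map_pmf (\<lambda>u. \<lambda>x\<in>T. poly (Poly (u @ s)) x) (pmf_of_set coeffs))"
      by (simp add: map_pmf_comp)
    also have "map_pmf (\<lambda>u. \<lambda>x\<in>T. poly (Poly (u @ s)) x) (pmf_of_set coeffs) =
        pmf_of_set (T \<rightarrow>\<^sub>E UNIV)"
      using evaluation_bij_betw[OF T(2), of s] coeffs_nonempty coeffs_finite
      unfolding coeffs_def by (intro map_pmf_of_set_bij_betw) auto
    finally show ?thesis .
  qed
  then show ?thesis by simp
qed

text \<open>Two dealings with equal shares on \<open>A\<close> come from polynomials with
  \<open>t + w\<close> coefficients that agree at \<open>t + w\<close> or more points, so they
  coincide and so do their secrets.\<close>

lemma recovery:
  assumes A: "A \<subseteq> {1..n}" "card A = k"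
  shows "\<exists>g. \<forall>s\<in>secrets scheme. \<forall>\<sigma>\<in>set_pmf (deal scheme s). g (restrict \<sigma> A) = s"
proof -
  have unique: "s = s'"
    if s: "length s = w" "length s' = w" and u: "u \<in> coeffs" "u' \<in> coeffs"
      and eq: "restrict (share_of (u @ s)) A = restrict (share_of (u' @ s')) A" for s s' u u'
  proof -
    have "u @ s = u' @ s'"
    proof (rule coeff_lists_eq_if_agree)
      show "length (u @ s) \<le> card (\<Union>i\<in>A. range (pts i))"
        using many[OF A] s u by (simp add: coeffs_def)
    next
      fix x assume "x \<in> (\<Union>i\<in>A. range (pts i))"
      then obtain i j where i: "i \<in> A" and x: "x = pts i j" by auto
      have "share_of (u @ s) i = share_of (u' @ s') i" using fun_cong[OF eq, of i] i by simp
      then show "poly (Poly (u @ s)) x = poly (Poly (u' @ s')) x"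
        using share_of_nth[of i _ j] i x A(1) by (metis subsetD)
    qed (use s u in \<open>auto simp: coeffs_def\<close>)
    then show ?thesis using u by (simp add: coeffs_def)
  qed
  \<comment> \<open>Decoding picks any secret consistent with the shares; \<open>unique\<close>
    shows that there is only one.\<close>
  define g where "g \<tau> = (SOME s. length s = w \<and> (\<exists>u\<in>coeffs. restrict (share_of (u @ s)) A = \<tau>))" for \<tau>
  have "g (restrict (share_of (u @ s)) A) = s" if "length s = w" "u \<in> coeffs" for s u
    unfolding g_def by (rule some_equality) (use that unique in blast)+
  then show ?thesis by (auto simp: set_deal)
qed

lemma threshold: "threshold_scheme k n scheme"
  unfolding threshold_scheme_def
proof (intro conjI ballI allI impI)
  show "secrets scheme \<noteq> {}"
    using length_replicate[of w "0::'f"] by (auto simp del: length_replicate)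
  show "set_pmf (deal scheme s) \<subseteq> {1..n} \<rightarrow>\<^sub>E shares scheme" for s
    by (auto simp: set_deal share_of_def)
  show "map_pmf (\<lambda>\<sigma>. restrict \<sigma> A) (deal scheme s) = map_pmf (\<lambda>\<sigma>. restrict \<sigma> A) (deal scheme s')"
    if "A \<subseteq> {1..n}" "card A = k - 1" for A s s'
    using that by (rule secrecy)
qed (fact recovery k_ge k_le finite_secrets | simp)+

section \<open>Repairing a share coordinate by coordinate\<close>

definition helper :: "nat \<Rightarrow> 'd \<Rightarrow> nat" where
  "helper l j = (SOME i. i \<in> {1..n} - {l} \<and> pts l j \<in> range (pts i))"

definition position :: "nat \<Rightarrow> 'd \<Rightarrow> 'd" where
  "position l j = (SOME j'. pts (helper l j) j' = pts l j)"

text \<open>Since \<open>helper l\<close> is injective for a player \<open>l\<close>,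
  \<open>inv (helper l) i\<close> is the coordinate for which \<open>i\<close> is responsible. The
  protocol is deterministic, which the constant randomness expresses, and a message is one field
  element wrapped in a list.\<close>

definition protocol :: "nat \<Rightarrow> ('f ^ 'd, nat, 'f list) repair_protocol" where
  "protocol l = \<lparr>helpers = range (helper l), randomness = \<lambda>_. return_pmf 0,
     exch_links = {}, exch_msg = \<lambda>_ _ _. [], rep_senders = range (helper l),
     rep_msg = \<lambda>i x _ _. [x $ position l (inv (helper l) i)],
     rebuild = \<lambda>\<mu>. \<chi> j. hd (\<mu> (helper l j))\<rparr>"

context
  fixes l assumes l: "l \<in> {1..n}"
begin

lemma helper_props: "helper l j \<in> {1..n} - {l} \<and> pts l j \<in> range (pts (helper l j))"
proof -
  have "\<exists>i. i \<in> {1..n} - {l} \<and> pts l j \<in> range (pts i)" using covered[OF l, of j] by blast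
  then show ?thesis unfolding helper_def by (rule someI_ex)
qed

lemma pts_position: "pts (helper l j) (position l j) = pts l j"
proof -
  have "\<exists>j'. pts (helper l j) j' = pts l j" using helper_props[of j] by (metis imageE)
  then show ?thesis unfolding position_def by (rule someI_ex)
qed

text \<open>A helper serving two coordinates would hold both points of the block of
  \<open>l\<close>, but two blocks meet in at most one point.\<close>

lemma inj_helper: "inj (helper l)"
proof (rule injI)
  fix j j' assume eq: "helper l j = helper l j'"
  have "pts l j = pts l j'"
    using helper_props[of j] helper_props[of j'] eq l
    by (intro meet[of l "helper l j"]) auto
  then show "j = j'" using inj_pts[OF l] by (simp add: inj_eq)
qed

lemma rep_transcript_protocol:
  "rep_transcript (protocol l) (\<sigma>, r) =
     (\<lambda>i\<in>range (helper l). [\<sigma> i $ position l (inv (helper l) i)])"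
  by (simp add: rep_transcript_def protocol_def)

lemma rep_transcript_share_of:
  "rep_transcript (protocol l) (share_of c, r) (helper l j) = [poly (Poly c) (pts l j)]"
  using helper_props[of j] by (simp add: rep_transcript_protocol inj_helper share_of_nth pts_position)

lemma executions_protocol:
  "executions scheme (protocol l) =
     (\<Union>s\<in>{s. length s = w}. (\<lambda>u. share_of (u @ s)) ` coeffs) \<times>
       set_pmf (Pi_pmf (range (helper l)) undefined (\<lambda>_. return_pmf 0))"
  by (auto simp: executions_def execution_def set_deal protocol_def)

text \<open>Every value is attained, already by constant polynomials.\<close>

lemma rep_space_protocol: "rep_space scheme (protocol l) (helper l j) = range (\<lambda>c. [c])"
proof
  show "rep_space scheme (protocol l) (helper l j) \<subseteq> range (\<lambda>c. [c])"
    by (auto simp: rep_space_def executions_protocol rep_transcript_share_of)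
next
  obtain r where r: "r \<in> set_pmf (Pi_pmf (range (helper l)) undefined (\<lambda>_. return_pmf (0::nat)))"
    using set_pmf_not_empty by fast
  have "[c] \<in> rep_space scheme (protocol l) (helper l j)" for c
  proof -
    let ?u = "c # replicate (t - 1) 0" and ?s = "replicate w (0::'f)"
    have zero: "poly (Poly (replicate a 0)) x = 0" for a and x :: 'f
      by (induction a) auto
    have "?u \<in> coeffs" using t_pos by (simp add: coeffs_def)
    then have "(share_of (?u @ ?s), r) \<in> executions scheme (protocol l)"
      unfolding executions_protocol using r
      by (intro SigmaI UN_I[of ?s] imageI[of ?u coeffs "\<lambda>u. share_of (u @ ?s)"]) auto
    moreover have "rep_transcript (protocol l) (share_of (?u @ ?s), r) (helper l j) = [c]"
      unfolding rep_transcript_share_of by (simp add: poly_Poly_append zero)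
    ultimately show ?thesis unfolding rep_space_def by force
  qed
  then show "range (\<lambda>c. [c]) \<subseteq> rep_space scheme (protocol l) (helper l j)" by auto
qed

lemma repairs_protocol: "repairs n CARD('d) scheme l (protocol l)"
proof -
  have "card (range (helper l)) = CARD('d)" by (rule card_image[OF inj_helper])
  moreover have "rebuild (protocol l) (rep_transcript (protocol l) (share_of c, r)) = share_of c l" for c r
    using l by (simp add: protocol_def rep_transcript_share_of[unfolded protocol_def] share_of_nth vec_eq_iff)
  ultimately show ?thesis
    using helper_props rep_space_protocol unfolding repairs_def executions_protocol
    by (auto simp: protocol_def)
qed

text \<open>The messages that a coalition sees are functions of its own shares: whatever a member sends
  is read off its share, and whatever \<open>l\<close> receives is a coordinate of the share being repaired.\<close>

lemma view_protocol_factors: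
  "\<exists>V. \<forall>c r. view l (protocol l) C (share_of c, r) = V (restrict (share_of c) C)"
proof -
  let ?S = "{i \<in> range (helper l). i \<in> C \<or> l \<in> C}"
  define M where "M \<tau> = (\<lambda>i\<in>?S. if l \<in> C then [\<tau> l $ inv (helper l) i]
      else [\<tau> i $ position l (inv (helper l) i)])" for \<tau> :: "nat \<Rightarrow> 'f ^ 'd"
  have "restrict (rep_transcript (protocol l) (share_of c, r)) ?S = M (restrict (share_of c) C)" for c r
  proof
    fix i
    show "restrict (rep_transcript (protocol l) (share_of c, r)) ?S i = M (restrict (share_of c) C) i"
    proof (cases "l \<in> C")
      case True
      then show ?thesis
        using l by (auto simp: M_def rep_transcript_share_of inj_helper share_of_nth)
    next
      case False
      then show ?thesis by (auto simp: M_def rep_transcript_protocol)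
    qed
  qed
  \<comment> \<open>Without exchange links the middle component is restricted to the empty set,
    hence constantly \<open>undefined\<close>.\<close>
  then have "view l (protocol l) C (share_of c, r) =
      (restrict (share_of c) C, \<lambda>_. undefined, M (restrict (share_of c) C))" for c r
    by (simp add: view_def protocol_def restrict_def fun_eq_iff)
  then show ?thesis by (intro exI[of _ "\<lambda>\<tau>. (\<tau>, \<lambda>_. undefined, M \<tau>)"]) simp
qed

text \<open>The distribution of the view is the image of that of the coalition's shares under a map
  \<open>V\<close> that does not depend on the secret, so \<open>secrecy\<close> carries over. The
  randomness disappears in the marginal on the shares.\<close>

lemma secure_protocol: "secure_repair k n scheme l (protocol l)"
  unfolding secure_repair_def
proof (intro allI impI ballI)
  fix C s s' assume C: "C \<subseteq> {1..n}" "card C = k - 1"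
  obtain V where V: "\<And>c r. view l (protocol l) C (share_of c, r) = V (restrict (share_of c) C)"
    using view_protocol_factors[of C] by blast
  have "map_pmf (view l (protocol l) C) (execution scheme (protocol l) s) =
      map_pmf V (map_pmf (\<lambda>\<sigma>. restrict \<sigma> C) (deal scheme s))" for s
  proof -
    have "map_pmf (view l (protocol l) C) (execution scheme (protocol l) s) =
        map_pmf (\<lambda>w. V (restrict (fst w) C)) (execution scheme (protocol l) s)"
      by (intro map_pmf_cong refl) (auto simp: execution_def set_deal V)
    also have "\<dots> = map_pmf V (map_pmf (\<lambda>\<sigma>. restrict \<sigma> C) (map_pmf fst (execution scheme (protocol l) s)))"
      by (simp add: map_pmf_comp)
    also have "map_pmf fst (execution scheme (protocol l) s) = deal scheme s"
      by (simp add: execution_def map_fst_pair_pmf)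
    finally show ?thesis .
  qed
  then show "map_pmf (view l (protocol l) C) (execution scheme (protocol l) s) =
      map_pmf (view l (protocol l) C) (execution scheme (protocol l) s')"
    using secrecy[OF C, of s s'] by simp
qed

text \<open>Each of the \<open>CARD('d)\<close> messages has the length of one field element and the
  secret that of \<open>w\<close>; the nonzero factor \<open>log 2 (real CARD('f))\<close>
  cancels.\<close>

lemma communication_complexity_protocol:
  "communication_complexity scheme (protocol l) = real CARD('d) / real w"
proof -
  have "bit_length (rep_space scheme (protocol l) (helper l j)) = log 2 (real CARD('f))" for j
    by (simp add: bit_length_def rep_space_protocol card_image inj_on_def)
  then have "(\<Sum>i\<in>rep_senders (protocol l). bit_length (rep_space scheme (protocol l) i)) =
      real CARD('d) * log 2 (real CARD('f))"
    by (simp add: protocol_def[THEN arg_cong[where f = rep_senders]] sum.reindex[OF inj_helper])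
  moreover have "exch_links (protocol l) = {}" by (simp add: protocol_def)
  moreover have "log 2 (real CARD('f)) \<noteq> 0" by (rule log_card_nonzero)
  ultimately show ?thesis by (simp add: communication_complexity_def bit_length_secrets del: scheme_simps)
qed

end

section \<open>Parameters of the resulting repairable scheme\<close>

lemma restricted_rts_scheme: "restricted_rts k n CARD('d) scheme protocol"
  using threshold repairs_protocol secure_protocol by (simp add: restricted_rts_def)

lemma information_rate_scheme: "information_rate scheme = real w / real CARD('d)"
  using log_card_nonzero[where 'f = 'f]
  by (simp add: information_rate_def bit_length_secrets del: scheme_simps(1))
    (simp add: bit_length_def log_nat_power)

lemma exists_rts:
  "\<exists>(D :: ('f list, 'f ^ 'd) sharing_scheme) (R :: nat \<Rightarrow> ('f ^ 'd, nat, 'f list) repair_protocol).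
     restricted_rts k n CARD('d) D R \<and> shares D = UNIV \<and>
     information_rate D = real w / real CARD('d) \<and>
     (\<forall>l\<in>{1..n}. communication_complexity D (R l) = real CARD('d) / real w)"
  using restricted_rts_scheme information_rate_scheme communication_complexity_protocol
  by (intro exI[of _ scheme] exI[of _ protocol]) simp

end

section \<open>Blocks of a resolvable design\<close>

lemma card_off_diagonal:
  assumes "finite B"
  shows "card {(x, y). x \<in> B \<and> y \<in> B \<and> x \<noteq> y} = card B * (card B - 1)"
proof -
  have "{(x, y). x \<in> B \<and> y \<in> B \<and> x \<noteq> y} = B \<times> B - (\<lambda>x. (x, x)) ` B" by auto
  moreover have "card (B \<times> B - (\<lambda>x. (x, x)) ` B) = card (B \<times> B) - card ((\<lambda>x. (x, x)) ` B)"
    using assms by (intro card_Diff_subset) auto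
  moreover have "card ((\<lambda>x. (x, x)) ` B) = card B" by (intro card_image inj_onI) auto
  ultimately show ?thesis by (simp add: card_cartesian_product diff_mult_distrib2)
qed

lemma bibd_finite_blocks:
  assumes "bibd m d X \<B>"
  shows "finite \<B>"
proof (rule finite_subset)
  show "\<B> \<subseteq> Pow X" using assms by (auto simp: bibd_def)
qed (use assms in \<open>simp add: bibd_def\<close>)

text \<open>Double counting of ordered pairs of distinct points: the sets \<open>off B\<close> of
  the blocks partition \<open>off X\<close>.\<close>

lemma bibd_card_blocks:
  assumes "bibd m d X \<B>"
  shows "card \<B> * (d * (d - 1)) = m * (m - 1)"
proof -
  define off where "off B = {(x, y). x \<in> B \<and> y \<in> B \<and> x \<noteq> y}" for B :: "'a set"
  have X: "finite X" "card X = m" and B: "\<And>B. B \<in> \<B> \<Longrightarrow> B \<subseteq> X \<and> card B = d"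
    and ex1: "\<And>x y. x \<in> X \<Longrightarrow> y \<in> X \<Longrightarrow> x \<noteq> y \<Longrightarrow> \<exists>!B. B \<in> \<B> \<and> x \<in> B \<and> y \<in> B"
    using assms by (auto simp: bibd_def)
  have fin: "finite B" if "B \<in> \<B>" for B using B[OF that] X(1) finite_subset by blast
  have "off X = (\<Union>B\<in>\<B>. off B)"
  proof (intro equalityI subsetI)
    fix p assume "p \<in> off X"
    then obtain x y where p: "p = (x, y)" "x \<in> X" "y \<in> X" "x \<noteq> y" by (auto simp: off_def)
    then show "p \<in> (\<Union>B\<in>\<B>. off B)" using ex1[OF p(2-4)] by (auto simp: off_def)
  next
    fix p assume "p \<in> (\<Union>B\<in>\<B>. off B)"
    then show "p \<in> off X" using B by (auto simp: off_def)
  qed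
  then have "card (off X) = (\<Sum>B\<in>\<B>. card (off B))"
  proof (simp only:, intro card_UN_disjoint ballI impI)
    show "finite \<B>" by (rule bibd_finite_blocks[OF assms])
    show "finite (off B)" if "B \<in> \<B>" for B
      by (rule finite_subset[of _ "B \<times> B"]) (use fin[OF that] in \<open>auto simp: off_def\<close>)
    show "off B \<inter> off B' = {}" if "B \<in> \<B>" "B' \<in> \<B>" "B \<noteq> B'" for B B'
    proof (rule ccontr)
      assume "off B \<inter> off B' \<noteq> {}"
      then obtain x y where xy: "x \<noteq> y" "x \<in> B" "y \<in> B" "x \<in> B'" "y \<in> B'"
        by (auto simp: off_def)
      then show False using ex1[of x y] B[OF that(1)] that by blast
    qed
  qed
  also have "\<dots> = (\<Sum>B\<in>\<B>. d * (d - 1))"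
    using fin B by (intro sum.cong refl) (auto simp: off_def card_off_diagonal)
  finally show ?thesis using X by (simp add: off_def card_off_diagonal)
qed

text \<open>The definition only asks for \<open>m / d\<close> disjoint blocks; having
  \<open>d\<close> points each, they contain \<open>m\<close> points together and so exhaust
  \<open>X\<close>.\<close>

lemma parallel_class_covers:
  assumes "bibd m d X \<B>" "P \<subseteq> \<B>" "parallel_class m d P" "d > 0"
  shows "\<Union>P = X"
proof -
  have P: "finite P" "disjoint P" "real (card P) = real m / real d"
    using assms(3) by (auto simp: parallel_class_def)
  have X: "finite X" "card X = m" and B: "\<And>B. B \<in> P \<Longrightarrow> B \<subseteq> X \<and> card B = d"
    using assms(1,2) by (auto simp: bibd_def)
  have "card (\<Union>P) = (\<Sum>B\<in>P. card B)"
    using P(2) B rev_finite_subset[OF X(1)] by (intro card_Union_disjoint) auto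
  also have "\<dots> = card P * d" using B by simp
  also have "real \<dots> = real m" using P(3) assms(4) by simp
  finally have "card (\<Union>P) = card X" using X by simp
  then show ?thesis using B X by (intro card_subset_eq) auto
qed

text \<open>Two parallel classes cover every point twice, so that each point of a block lies in
  another of the selected blocks.\<close>

lemma resolvable_bibd_subdesign:
  assumes "resolvable_bibd m d X \<B>" "d > 0" "m > 0"
    and "2 * real m / real d \<le> real n" "n \<le> card \<B>"
  shows "\<exists>\<S>\<subseteq>\<B>. card \<S> = n \<and> (\<forall>x\<in>X. \<forall>B\<in>\<S>. \<exists>B'\<in>\<S> - {B}. x \<in> B')"
proof -
  obtain \<C> where bibd: "bibd m d X \<B>" and part: "partition_on \<B> \<C>"
    and par: "\<And>P. P \<in> \<C> \<Longrightarrow> parallel_class m d P"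
    using assms(1) by (auto simp: resolvable_bibd_def)
  have fin: "finite \<B>" by (rule bibd_finite_blocks[OF bibd])
  have md: "real m / real d > 0" using assms by simp
  have large: "real (card \<B>) \<ge> 2 * (real m / real d)" using assms by simp
  have un: "\<Union>\<C> = \<B>" using part by (simp add: partition_on_def)
  have "\<B> \<noteq> {}" using large md by auto
  then obtain P where P: "P \<in> \<C>" using un by auto
  \<comment> \<open>A single class has only \<open>m / d\<close> blocks, while there are at least
    twice as many in all, so a second class exists.\<close>
  have "P \<noteq> \<B>" using par[OF P] large md by (auto simp: parallel_class_def)
  then obtain P' where P': "P' \<in> \<C>" "P' \<noteq> P" using un P by blast
  have disj: "P \<inter> P' = {}" using part P P' by (auto simp: partition_on_def disjoint_def)
  have sub: "P \<subseteq> \<B>" "P' \<subseteq> \<B>" using un P P' by auto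
  have "real (card (P \<union> P')) = 2 * (real m / real d)"
    using par[OF P] par[OF P'(1)] disj by (simp add: parallel_class_def card_Un_disjoint)
  then have "card (P \<union> P') \<le> n" using assms(4) by simp
  then obtain \<S> where S: "P \<union> P' \<subseteq> \<S>" "\<S> \<subseteq> \<B>" "card \<S> = n"
    using exists_subset_between[of "P \<union> P'" n \<B>] sub assms(5) fin by auto
  have "\<exists>B'\<in>\<S> - {B}. x \<in> B'" if "x \<in> X" for x B
  proof -
    have "x \<in> \<Union>P" "x \<in> \<Union>P'"
      using that parallel_class_covers[OF bibd] sub par P P' assms(2) by auto
    \<comment> \<open>The blocks through \<open>x\<close> in the two classes are different, so at
      least one of them is not \<open>B\<close>.\<close>
    then show ?thesis using disj S(1) by blast
  qed
  then show ?thesis using S by blast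
qed

text \<open>Transports a subdesign with doubly covered points to the field: \<open>f\<close> embeds
  the points, \<open>b\<close> assigns the selected blocks to the players, and \<open>e\<close>
  orders the points within each block.\<close>

lemma block_points_in_field:
  fixes X :: "'p set"
  assumes "resolvable_bibd m CARD('d::finite) X \<B>" "m > 0"
    and "m \<le> CARD('f::finite)"
    and "2 * real m / real CARD('d) \<le> real n" "n \<le> card \<B>"
  obtains pts :: "nat \<Rightarrow> 'd::finite \<Rightarrow> 'f::finite" where
    "\<And>i. i \<in> {1..n} \<Longrightarrow> inj (pts i)"
    "\<And>i i' x y. i \<in> {1..n} \<Longrightarrow> i' \<in> {1..n} \<Longrightarrow> i \<noteq> i' \<Longrightarrow>
      x \<in> range (pts i) \<inter> range (pts i') \<Longrightarrow> y \<in> range (pts i) \<inter> range (pts i') \<Longrightarrow> x = y"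
    "\<And>i j. i \<in> {1..n} \<Longrightarrow> \<exists>i'\<in>{1..n} - {i}. pts i j \<in> range (pts i')"
proof -
  have bibd: "bibd m CARD('d) X \<B>" using assms(1) by (simp add: resolvable_bibd_def)
  then have X: "finite X" "card X = m" and B: "\<And>B. B \<in> \<B> \<Longrightarrow> B \<subseteq> X \<and> card B = CARD('d)"
    and ex1: "\<And>x y. x \<in> X \<Longrightarrow> y \<in> X \<Longrightarrow> x \<noteq> y \<Longrightarrow> \<exists>!B. B \<in> \<B> \<and> x \<in> B \<and> y \<in> B"
    by (auto simp: bibd_def)
  obtain \<S> where S: "\<S> \<subseteq> \<B>" "card \<S> = n"
    "\<And>x B. x \<in> X \<Longrightarrow> B \<in> \<S> \<Longrightarrow> \<exists>B'\<in>\<S> - {B}. x \<in> B'"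
    using resolvable_bibd_subdesign[OF assms(1) zero_less_card_finite assms(2,4,5)] by metis
  obtain f :: "'p \<Rightarrow> 'f" where f: "inj_on f X"
    using card_le_inj[of X "UNIV :: 'f set"] X assms(3) by (metis finite)
  have "finite \<S>" using S(1) bibd_finite_blocks[OF bibd] finite_subset by blast
  then obtain b where b: "bij_betw b {1..n} \<S>"
    using S(2) finite_same_card_bij[of "{1..n}" \<S>] by auto
  have "\<exists>e. bij_betw e (UNIV :: 'd set) B" if "B \<in> \<B>" for B
    using B[OF that] rev_finite_subset[OF X(1)] finite_same_card_bij[of "UNIV :: 'd set" B] by simp
  then obtain e where e: "\<And>B. B \<in> \<B> \<Longrightarrow> bij_betw (e B) (UNIV :: 'd set) B" by metis
  define pts where "pts i j = f (e (b i) j)" for i j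
  have bS: "b i \<in> \<S>" "b i \<in> \<B>" "b i \<subseteq> X" if "i \<in> {1..n}" for i
    using bij_betwE[OF b] that S(1) B by blast+
  have rng: "range (pts i) = f ` b i" if "i \<in> {1..n}" for i
    using e[OF bS(2)[OF that]] unfolding bij_betw_def pts_def by (metis image_image)
  show ?thesis
  proof
    show "inj (pts i)" if i: "i \<in> {1..n}" for i
    proof -
      have "inj (e (b i))" "range (e (b i)) = b i"
        using e[OF bS(2)[OF i]] by (auto simp: bij_betw_def)
      then have "inj (f \<circ> e (b i))"
        using bS(3)[OF i] f by (intro comp_inj_on) (auto intro: inj_on_subset)
      then show ?thesis by (simp add: pts_def[abs_def] comp_def)
    qed
  next
    fix i i' x y
    assume i: "i \<in> {1..n}" "i' \<in> {1..n}" "i \<noteq> i'"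
      and xy: "x \<in> range (pts i) \<inter> range (pts i')" "y \<in> range (pts i) \<inter> range (pts i')"
    have ne: "b i \<noteq> b i'" using bij_betw_imp_inj_on[OF b] i by (simp add: inj_on_eq_iff)
    \<comment> \<open>Injectivity of \<open>f\<close> turns common field elements into common points
      of two distinct blocks, and the design allows at most one of these.\<close>
    have "range (pts i) \<inter> range (pts i') = f ` (b i \<inter> b i')"
      unfolding rng[OF i(1)] rng[OF i(2)]
      by (rule inj_on_image_Int[OF f bS(3)[OF i(1)] bS(3)[OF i(2)], symmetric])
    then obtain a c where ac: "a \<in> b i \<inter> b i'" "c \<in> b i \<inter> b i'" "x = f a" "y = f c"
      using xy by (metis imageE)
    have "a = c" using ne ex1[of a c] ac(1,2) bS(2,3)[OF i(1)] bS(2)[OF i(2)] by blast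
    then show "x = y" using ac by simp
  next
    fix i j assume i: "i \<in> {1..n}"
    have in_b: "e (b i) j \<in> b i" using e[OF bS(2)[OF i]] by (auto simp: bij_betw_def)
    then obtain B' where B': "B' \<in> \<S> - {b i}" "e (b i) j \<in> B'"
      using S(3) bS(1,3)[OF i] by blast
    then obtain i' where i': "i' \<in> {1..n}" "B' = b i'"
      using bij_betw_imp_surj_on[OF b] by (metis DiffD1 imageE)
    then have "pts i j \<in> range (pts i')" "i' \<noteq> i" using B' unfolding rng[OF i'(1)] by (auto simp: pts_def)
    then show "\<exists>i'\<in>{1..n} - {i}. pts i j \<in> range (pts i')" using i' by blast
  qed
qed

section \<open>The two choices of parameters\<close>

theorem theorem5p3:
  fixes m n Q :: nat
  assumes "m > 0" and "[m = 5] (mod 20)"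
    and "\<exists>(X :: 'p set) \<B>. resolvable_bibd m 5 X \<B>"
    and "primepow Q" and "CARD('f :: {field, finite}) = Q" and "Q \<ge> m + 1"
    and "2 * real m / 5 \<le> real n" and "real n \<le> real m * (real m - 1) / 20"
  shows "(\<exists>(D :: ('f list, 'f ^ 5) sharing_scheme) (R :: nat \<Rightarrow> ('f ^ 5, nat, 'f list) repair_protocol).
            restricted_rts 2 n 5 D R \<and> shares D = UNIV \<and> information_rate D = 4 / 5 \<and>
            (\<forall>l\<in>{1..n}. communication_complexity D (R l) = 5 / 4)) \<and>
         (\<exists>(D :: ('f list, 'f ^ 5) sharing_scheme) (R :: nat \<Rightarrow> ('f ^ 5, nat, 'f list) repair_protocol).
            restricted_rts 3 n 5 D R \<and> shares D = UNIV \<and> information_rate D = 2 / 5 \<and>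
            (\<forall>l\<in>{1..n}. communication_complexity D (R l) = 5 / 2))"
proof -
  obtain X :: "'p set" and \<B> where design: "resolvable_bibd m 5 X \<B>" using assms(3) by blast
  \<comment> \<open>With \<open>d = 5\<close> the block count is \<open>m * (m - 1) / 20\<close>,
    exactly the upper bound on \<open>n\<close>.\<close>
  then have "card \<B> * 20 = m * (m - 1)"
    using bibd_card_blocks[of m 5 X \<B>] by (simp add: resolvable_bibd_def)
  then have "real (card \<B>) * 20 = real m * (real m - 1)"
    using assms(1) by (metis of_nat_mult of_nat_numeral of_nat_diff of_nat_1 Suc_leI One_nat_def)
  then have n_le: "n \<le> card \<B>" using assms(8) by simp
  \<comment> \<open>For \<open>m = 5\<close> the bounds would read 2 <= \<open>n\<close> <= 1. The
    next value in the residue class is 25, whence \<open>n\<close> >= 10 and the field has more than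
    25 elements, enough for \<open>t = 5\<close> and \<open>t = 10\<close>.\<close>
  have "m \<noteq> 5" using assms(7,8) by auto
  moreover have "m mod 20 = 5" using assms(2) by (simp add: Cong.cong_def)
  ultimately have m: "m \<ge> 25" by presburger
  then have n: "n \<ge> 10" using assms(7) by linarith
  obtain pts :: "nat \<Rightarrow> 5 \<Rightarrow> 'f" where
    inj: "\<And>i. i \<in> {1..n} \<Longrightarrow> inj (pts i)" and
    meet: "\<And>i i' x y. i \<in> {1..n} \<Longrightarrow> i' \<in> {1..n} \<Longrightarrow> i \<noteq> i' \<Longrightarrow>
      x \<in> range (pts i) \<inter> range (pts i') \<Longrightarrow> y \<in> range (pts i) \<inter> range (pts i') \<Longrightarrow> x = y" and
    cov: "\<And>i j. i \<in> {1..n} \<Longrightarrow> \<exists>i'\<in>{1..n} - {i}. pts i j \<in> range (pts i')"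
  proof (rule block_points_in_field[where 'd = 5 and 'f = 'f])
    show "resolvable_bibd m CARD(5) X \<B>" using design by simp
    show "m > 0" "m \<le> CARD('f)" "2 * real m / real CARD(5) \<le> real n" "n \<le> card \<B>"
      using assms(1,5,6,7) n_le by simp_all
  qed (erule that)
  have one: "card (range (pts i)) = 5" if "i \<in> {1..n}" for i
    using card_image[OF inj[OF that]] by simp
  have inter: "card (range (pts i) \<inter> range (pts i')) \<le> 1"
    if "i \<in> {1..n}" "i' \<in> {1..n}" "i \<noteq> i'" for i i'
    unfolding One_nat_def card_le_Suc0_iff_eq[OF finite] by (intro ballI meet[OF that])
  have two: "9 \<le> card (range (pts i) \<union> range (pts i'))" "card (range (pts i) \<union> range (pts i')) \<le> 10"
    if "i \<in> {1..n}" "i' \<in> {1..n}" "i \<noteq> i'" for i i'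
    using card_Un_Int[of "range (pts i)" "range (pts i')"] one[of i] one[of i'] inter[of i i'] that
    by simp_all
  have three: "12 \<le> card (range (pts i) \<union> range (pts i') \<union> range (pts i''))"
    if "i \<in> {1..n}" "i' \<in> {1..n}" "i'' \<in> {1..n}" "i \<noteq> i'" "i \<noteq> i''" "i' \<noteq> i''" for i i' i''
  proof -
    \<comment> \<open>The third block meets each of the other two in at most one point, so it adds
      at least 3 points to their 9 or more.\<close>
    have "card ((range (pts i) \<union> range (pts i')) \<inter> range (pts i'')) \<le>
        card (range (pts i) \<inter> range (pts i'')) + card (range (pts i') \<inter> range (pts i''))"
      by (metis card_Un_le Int_Un_distrib2)
    then show ?thesis
      using card_Un_Int[of "range (pts i) \<union> range (pts i')" "range (pts i'')"]
        one[of i''] two[of i i'] inter[of i i''] inter[of i' i''] that by simp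
  qed
  \<comment> \<open>The numbers are \<open>k\<close>, \<open>t\<close> and \<open>w\<close>; the
    rate is \<open>w / 5\<close> and the communication complexity \<open>5 / w\<close>.\<close>
  have "evaluation_rts pts n 2 5 4"
  proof
    fix A assume A: "A \<subseteq> {1..n}"
    show "card (\<Union>i\<in>A. range (pts i)) \<le> 5" if card_A: "card A = 2 - 1"
    proof -
      obtain i where "A = {i}" using card_A card_1_singletonE[of A] by auto
      then show ?thesis using A one[of i] by simp
    qed
    show "5 + 4 \<le> card (\<Union>i\<in>A. range (pts i))" if card_A: "card A = 2"
    proof -
      obtain i i' where "A = {i, i'}" "i \<noteq> i'" using card_A card_2_iff[of A] by auto
      then show ?thesis using A two(1)[of i i'] by simp
    qed
  qed (fact inj meet cov | use n m assms in simp)+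
  moreover have "evaluation_rts pts n 3 10 2"
  proof
    fix A assume A: "A \<subseteq> {1..n}"
    show "card (\<Union>i\<in>A. range (pts i)) \<le> 10" if card_A: "card A = 3 - 1"
    proof -
      obtain i i' where "A = {i, i'}" "i \<noteq> i'" using card_A card_2_iff[of A] by auto
      then show ?thesis using A two(2)[of i i'] by simp
    qed
    show "10 + 2 \<le> card (\<Union>i\<in>A. range (pts i))" if card_A: "card A = 3"
    proof -
      obtain i i' i'' where "A = {i, i', i''}" "i \<noteq> i'" "i \<noteq> i''" "i' \<noteq> i''"
        using card_A card_3_iff[of A] by auto
      then show ?thesis using A three[of i i' i''] by (simp add: Un_assoc)
    qed
  qed (fact inj meet cov | use n m assms in simp)+
  ultimately show ?thesis
    using evaluation_rts.exists_rts[of pts n 2 5 4] evaluation_rts.exists_rts[of pts n 3 10 2] by simp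
qed

end
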